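(* Let $k,\ell\ge 3$ be distinct integers, regarded as constants. If $k\nmid \ell$, then $\mathrm{ex}(n,\overrightarrow{C}_k,\overrightarrow{C}_\ell)=\Theta(n^{k})$. If $k\mid \ell$, then $\mathrm{ex}(n,\overrightarrow{C}_k,\overrightarrow{C}_\ell)=\Theta(n^{k-1})$.
   Context: An oriented graph is a directed graph without loops in which every pair of vertices is joined by at most one arc (in one direction). $\overrightarrow{C}_m$ denotes the directed cycle of length $m$ (vertices $v_1,\dots,v_m$, arcs $v_1v_2,\dots,v_{m-1}v_m,v_mv_1$). A copy of a graph $H$ in $G$ is a (not necessarily induced) subgraph of $G$ isomorphic to $H$. $\mathrm{ex}(n,\overrightarrow{C}_k,\overrightarrow{C}_\ell)$ is the maximum number of copies of $\overrightarrow{C}_k$ in an $n$-vertex oriented graph containing no copy of $\overrightarrow{C}_\ell$. Asymptotic notation is as $n\to\infty$ with $k,\ell$ fixed. *)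

theory Defs
  imports "Graph_Theory.Graph_Theory" "HOL-Library.Landau_Symbols"
begin

definition oriented_graph :: "'a pair_pre_digraph \<Rightarrow> bool" where
  "oriented_graph G \<longleftrightarrow>
     pair_digraph G \<and> (\<forall>u v. (u, v) \<in> parcs G \<longrightarrow> (v, u) \<notin> parcs G)"

definition dicycle :: "nat \<Rightarrow> nat pair_pre_digraph" where
  "dicycle m = \<lparr> pverts = {..<m}, parcs = {(i, Suc i mod m) | i. i < m} \<rparr>"

definition copies :: "'b pair_pre_digraph \<Rightarrow> 'a pair_pre_digraph \<Rightarrow> 'a pair_pre_digraph set" where
  "copies H G = {K. subgraph (with_proj K) (with_proj G) \<and> digraph_iso (with_proj K) (with_proj H)}"

text \<open>
  Every finite graph is isomorphic to one with vertices in \<^typ>\<open>nat\<close>, so restricting the vertex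
  type loses nothing.  The vertex set itself is arbitrary, so infinitely many graphs are
  considered, but the set of copy numbers is finite (\<open>finite_copy_numbers\<close>) and, for a
  forbidden directed cycle of length at least 2, nonempty (\<open>copy_numbers_nonempty\<close>), so that \<open>Max\<close> is a genuine maximum.
\<close>

definition copy_numbers :: "nat \<Rightarrow> 'b pair_pre_digraph \<Rightarrow> 'c pair_pre_digraph \<Rightarrow> nat set" where
  "copy_numbers n H F =
     {card (copies H G) | G :: nat pair_pre_digraph.
        oriented_graph G \<and> card (pverts G) = n \<and> copies F G = {}}"

definition ex_oriented :: "nat \<Rightarrow> 'b pair_pre_digraph \<Rightarrow> 'c pair_pre_digraph \<Rightarrow> nat" where
  "ex_oriented n H F = Max (copy_numbers n H F)"

lemma copies_bound:
  fixes G :: "'a pair_pre_digraph"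
  assumes "oriented_graph G" "card (pverts G) = n"
  shows "finite (copies H G)" "card (copies H G) \<le> 2 ^ n * 2 ^ (n * n)"
proof -
  have pd: "pair_digraph G" using assms(1) by (simp add: oriented_graph_def)
  interpret pair_digraph G by fact
  have fin: "finite (pverts G)" by (rule pair_finite_verts)
  define f :: "'a pair_pre_digraph \<Rightarrow> _" where "f K = (pverts K, parcs K)" for K
  let ?B = "Pow (pverts G) \<times> Pow (pverts G \<times> pverts G)"
  have sub: "parcs G \<subseteq> pverts G \<times> pverts G" using wellformed' by auto
  have img: "f ` copies H G \<subseteq> ?B"
  proof
    fix x assume "x \<in> f ` copies H G"
    then obtain K where K: "K \<in> copies H G" "x = f K" by auto
    then have "pverts K \<subseteq> pverts G" "parcs K \<subseteq> parcs G"
      by (auto simp: copies_def subgraph_def)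
    with sub K(2) show "x \<in> ?B" by (auto simp: f_def)
  qed
  have inj: "inj_on f (copies H G)" by (auto simp: inj_on_def f_def)
  have finB: "finite ?B" using fin by simp
  show "finite (copies H G)" using finite_subset[OF img finB] inj by (rule finite_imageD)
  have "card (copies H G) \<le> card ?B" by (rule card_inj_on_le[OF inj img finB])
  also have "\<dots> = 2 ^ n * 2 ^ (n * n)"
    using fin assms(2) by (simp add: card_cartesian_product card_Pow)
  finally show "card (copies H G) \<le> 2 ^ n * 2 ^ (n * n)" .
qed

lemma finite_copy_numbers: "finite (copy_numbers n H F)"
proof (rule finite_subset)
  show "copy_numbers n H F \<subseteq> {..2 ^ n * 2 ^ (n * n)}"
    using copies_bound(2) by (fastforce simp: copy_numbers_def)
qed simp

lemma copy_numbers_nonempty: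
  assumes "l \<ge> 2"
  shows "copy_numbers n H (dicycle l) \<noteq> {}"
proof -
  let ?G = "\<lparr> pverts = {..<n}, parcs = {} \<rparr> :: nat pair_pre_digraph"
  have "pair_digraph ?G" by unfold_locales auto
  moreover have "copies (dicycle l) ?G = {}"
  proof (rule ccontr)
    assume "copies (dicycle l) ?G \<noteq> {}"
    then obtain K :: "nat pair_pre_digraph" where "parcs K = {}" "digraph_iso (with_proj K) (with_proj (dicycle l))"
      by (auto simp: copies_def subgraph_def)
    then have "arcs (with_proj (dicycle l)) = {}"
      unfolding digraph_iso_def by (metis arcs_app_iso image_empty with_proj_simps(2))
    moreover have "(0, Suc 0 mod l) \<in> parcs (dicycle l)" using assms by (force simp: dicycle_def)
    ultimately show False by simp
  qed
  ultimately show ?thesis unfolding copy_numbers_def oriented_graph_def by force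
qed

end

theory Submission
  imports Defs
begin

text \<open>
  Lower bounds: a cycle in a blow-up of the directed \<open>k\<close>-cycle has length divisible by \<open>k\<close>, and if
  one class of the blow-up is a single vertex, its only cycles are those of length \<open>k\<close>.

  Upper bound for \<open>k dvd l\<close>: view the \<open>k\<close>-cycles as \<open>k\<close>-tuples of vertices.  If there are more than
  \<open>l k n\<^sup>k\<^sup>-\<^sup>1\<close> of them, repeatedly discarding all tuples that extend a \<open>(k-1)\<close>-tuple with few
  extensions leaves a nonempty set \<open>T\<close> in which every coordinate of every tuple can be replaced by
  more than \<open>l\<close> vertices.  Given a cycle through an arc \<open>a\<^sub>0 a\<^sub>1\<close> with \<open>(a\<^sub>0, a\<^sub>1, b\<^sub>2, \<dots>) \<in> T\<close>, first
  replace \<open>b\<^sub>2, \<dots>\<close> by fresh \<open>b'\<^sub>2, \<dots>\<close>, and from the resulting tuple replace \<open>a\<^sub>1\<close> by a fresh \<open>a'\<^sub>1\<close> and,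
  independently, \<open>a\<^sub>0\<close> by a fresh \<open>a'\<^sub>0\<close>.  Then \<open>a\<^sub>0 a'\<^sub>1 b'\<^sub>2 \<dots> a'\<^sub>0 a\<^sub>1\<close> is a path that can replace the arc
  \<open>a\<^sub>0 a\<^sub>1\<close>, which makes the cycle longer by \<open>k\<close>, and the new arc \<open>a'\<^sub>0 a\<^sub>1\<close> again belongs to a tuple of \<open>T\<close>.
  Iterating yields a cycle of length \<open>l\<close>.
\<close>

section \<open>Copies of a directed cycle as lists of vertices\<close>

definition dicycle_of :: "'a list \<Rightarrow> 'a pair_pre_digraph" where
  "dicycle_of xs =
     \<lparr> pverts = set xs, parcs = {(xs ! i, xs ! (Suc i mod length xs)) | i. i < length xs} \<rparr>"

text \<open>For \<open>m > 0\<close> a cycle is listed once for each starting vertex. This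
  overcounts copies by the constant factor \<open>m\<close>, which does not affect the asymptotics,
  and leaves tuples whose coordinates can be varied one at a time.\<close>

definition dicycles :: "nat \<Rightarrow> 'a pair_pre_digraph \<Rightarrow> 'a list set" where
  "dicycles m G =
     {xs. length xs = m \<and> distinct xs \<and> (\<forall>i<m. (xs ! i, xs ! (Suc i mod m)) \<in> parcs G)}"

lemma arc_of_dicycles:
  "xs \<in> dicycles m G \<Longrightarrow> i < m \<Longrightarrow> (xs ! i, xs ! (Suc i mod m)) \<in> parcs G"
  unfolding dicycles_def by blast

lemma pverts_dicycle_of [simp]: "pverts (dicycle_of xs) = set xs"
  by (simp add: dicycle_of_def)

lemma parcs_dicycle_of:
  "parcs (dicycle_of xs) = (\<lambda>i. (xs ! i, xs ! (Suc i mod length xs))) ` {..<length xs}"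
  by (auto simp: dicycle_of_def)

lemma dicycle_eq_dicycle_of: "dicycle m = dicycle_of [0..<m]"
proof -
  have "m > 0 \<Longrightarrow> Suc i mod m < m" for i by simp
  then show ?thesis
    unfolding dicycle_def dicycle_of_def
    by (auto simp: nth_upt intro!: exI)
qed

text \<open>In a pair digraph an arc is its pair of ends, so the vertex map of an isomorphism
  determines its arc map.\<close>

lemma digraph_iso_with_proj_iff:
  "digraph_iso (with_proj K) (with_proj H) \<longleftrightarrow>
     pair_wf_digraph K \<and>
     (\<exists>f. inj_on f (pverts K) \<and> pverts H = f ` pverts K \<and> parcs H = map_prod f f ` parcs K)"
  (is "?L \<longleftrightarrow> ?R")
proof
  assume ?L
  then obtain h where h: "pre_digraph.digraph_isomorphism (with_proj K) h"
    and H: "with_proj H = app_iso h (with_proj K)"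
    by (auto simp: digraph_iso_def)
  then have wf: "wf_digraph (with_proj K)"
    by (simp add: pre_digraph.digraph_isomorphism_def)
  have "arcs_ends (with_proj H) = map_prod (iso_verts h) (iso_verts h) ` arcs_ends (with_proj K)"
    unfolding H wf_digraph.arcs_ends_app_iso_eq[OF wf h] map_prod_def by simp
  moreover have "verts (with_proj H) = iso_verts h ` verts (with_proj K)"
    unfolding H by simp
  ultimately show ?R
    using pre_digraph.digraph_isomorphism_inj_on_verts[OF h] wf
    by (auto simp: wf_digraph_wp_iff intro!: exI[of _ "iso_verts h"])
next
  assume ?R
  then obtain f where wf: "pair_wf_digraph K" and f: "inj_on f (pverts K)"
    "pverts H = f ` pverts K" "parcs H = map_prod f f ` parcs K" by auto
  interpret pair_wf_digraph K by fact
  define h where "h = \<lparr>iso_verts = f, iso_arcs = map_prod f f, iso_head = snd, iso_tail = fst\<rparr>"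
  have "inj_on (map_prod f f) (parcs K)"
    by (rule inj_on_subset[OF map_prod_inj_on[OF f(1) f(1)]])
       (auto dest: arc_fst_in_verts arc_snd_in_verts)
  then have "pre_digraph.digraph_isomorphism (with_proj K) h"
    using f(1) wf by (auto simp: pre_digraph.digraph_isomorphism_def h_def wf_digraph_wp_iff)
  moreover have "with_proj H = app_iso h (with_proj K)"
    using f by (simp add: with_proj_def app_iso_def h_def)
  ultimately show ?L by (auto simp: digraph_iso_def)
qed

lemma dicycle_of_map:
  "pverts (dicycle_of (map f xs)) = f ` pverts (dicycle_of xs)"
  "parcs (dicycle_of (map f xs)) = map_prod f f ` parcs (dicycle_of xs)"
proof -
  show "pverts (dicycle_of (map f xs)) = f ` pverts (dicycle_of xs)" by simp
  have "Suc i mod length xs < length xs" if "i < length xs" for i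
    using that by (intro mod_less_divisor) linarith
  then show "parcs (dicycle_of (map f xs)) = map_prod f f ` parcs (dicycle_of xs)"
    unfolding parcs_dicycle_of image_image by (intro image_cong) simp_all
qed

lemma wf_dicycle_of: "pair_wf_digraph (dicycle_of xs)"
proof
  fix e assume "e \<in> parcs (dicycle_of xs)"
  then obtain i where "i < length xs" "e = (xs ! i, xs ! (Suc i mod length xs))"
    by (auto simp: parcs_dicycle_of)
  moreover from this have "Suc i mod length xs < length xs" by (intro mod_less_divisor) linarith
  ultimately show "fst e \<in> pverts (dicycle_of xs)" "snd e \<in> pverts (dicycle_of xs)"
    by auto
qed

text \<open>The inverse of an isomorphism, applied to \<open>[0..<m]\<close>, lists the vertices in
  cyclic order. Conversely, sending each vertex to its position in \<open>xs\<close> is an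
  isomorphism.\<close>

lemma digraph_iso_dicycle_iff:
  "digraph_iso (with_proj K) (with_proj (dicycle m)) \<longleftrightarrow>
     (\<exists>xs. length xs = m \<and> distinct xs \<and> K = dicycle_of xs)"
proof
  assume "digraph_iso (with_proj K) (with_proj (dicycle m))"
  then obtain f where wf: "pair_wf_digraph K" and inj: "inj_on f (pverts K)"
    and V: "set [0..<m] = f ` pverts K"
    and E: "parcs (dicycle_of [0..<m]) = map_prod f f ` parcs K"
    by (auto simp: digraph_iso_with_proj_iff dicycle_eq_dicycle_of)
  interpret pair_wf_digraph K by fact
  define g where "g = the_inv_into (pverts K) f"
  define xs where "xs = map g [0..<m]"
  have gf: "g (f v) = v" if "v \<in> pverts K" for v
    unfolding g_def by (rule the_inv_into_f_f[OF inj that])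
  have "inj_on g (set [0..<m])"
    unfolding g_def V by (rule inj_on_the_inv_into[OF inj])
  then have "distinct xs" by (simp add: xs_def distinct_map)
  moreover have "pverts (dicycle_of xs) = pverts K"
    unfolding xs_def dicycle_of_map(1) pverts_dicycle_of(1)[of "[0..<m]"] V image_image
    using gf by simp
  moreover have "parcs (dicycle_of xs) = parcs K"
  proof -
    have "parcs (dicycle_of xs) = (\<lambda>e. map_prod g g (map_prod f f e)) ` parcs K"
      unfolding xs_def dicycle_of_map E image_image ..
    also have "\<dots> = (\<lambda>e. e) ` parcs K"
      using wellformed' by (intro image_cong refl) (auto simp: gf)
    finally show ?thesis by simp
  qed
  ultimately show "\<exists>xs. length xs = m \<and> distinct xs \<and> K = dicycle_of xs"
    by (intro exI[of _ xs]) (simp add: xs_def)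
next
  assume "\<exists>xs. length xs = m \<and> distinct xs \<and> K = dicycle_of xs"
  then obtain xs where xs: "length xs = m" "distinct xs" and K: "K = dicycle_of xs" by auto
  define f where "f = the_inv_into {..<m} ((!) xs)"
  have inj: "inj_on ((!) xs) {..<m}" using xs by (simp add: inj_on_nth)
  have img: "(!) xs ` {..<m} = set xs" using xs by (auto simp: set_conv_nth)
  have f: "map f xs = [0..<m]"
    using xs the_inv_into_f_f[OF inj] by (intro nth_equalityI) (auto simp: f_def)
  have "inj_on f (set xs)"
    unfolding f_def img[symmetric] by (rule inj_on_the_inv_into[OF inj])
  then show "digraph_iso (with_proj K) (with_proj (dicycle m))"
    unfolding digraph_iso_with_proj_iff dicycle_eq_dicycle_of f[symmetric] dicycle_of_map K
    using wf_dicycle_of by auto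
qed

lemma copies_dicycle:
  assumes "pair_wf_digraph G"
  shows "copies (dicycle m) G = dicycle_of ` dicycles m G"
proof -
  interpret pair_wf_digraph G by fact
  have "subgraph (with_proj (dicycle_of xs)) (with_proj G) \<longleftrightarrow>
      (\<forall>i<length xs. (xs ! i, xs ! (Suc i mod length xs)) \<in> parcs G)" (is "?L \<longleftrightarrow> ?R") for xs
  proof
    assume ?R
    \<comment> \<open>Every vertex of the cycle is the tail of one of its arcs.\<close>
    then have "set xs \<subseteq> pverts G"
      by (fastforce simp: in_set_conv_nth dest: arc_fst_in_verts)
    with \<open>?R\<close> show ?L
      using assms wf_dicycle_of[of xs]
      by (auto simp: subgraph_def wf_digraph_wp_iff parcs_dicycle_of compatible_def)
  qed (auto simp: subgraph_def parcs_dicycle_of)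
  then show ?thesis
    unfolding copies_def digraph_iso_dicycle_iff by (auto simp: dicycles_def)
qed

text \<open>A path with a closing arc behaves well under concatenation, which indices modulo
  \<open>m\<close> do not; this form serves to rotate cycles and to splice a path into one.\<close>

lemma dicycles_iff_successively:
  assumes "m > 0"
  shows "xs \<in> dicycles m G \<longleftrightarrow> length xs = m \<and> distinct xs \<and>
     successively (\<lambda>u v. (u, v) \<in> parcs G) xs \<and> (last xs, hd xs) \<in> parcs G"
proof -
  have "(\<forall>i<m. (xs ! i, xs ! (Suc i mod m)) \<in> parcs G) \<longleftrightarrow>
      (\<forall>i. Suc i < length xs \<longrightarrow> (xs ! i, xs ! Suc i) \<in> parcs G) \<and> (last xs, hd xs) \<in> parcs G"
    if "length xs = m"
  proof -
    obtain j where m: "m = Suc j" using assms gr0_conv_Suc by blast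
    have "xs \<noteq> []" using that assms by auto
    then have "last xs = xs ! j" "hd xs = xs ! 0"
      using that m by (auto simp: last_conv_nth hd_conv_nth)
    \<comment> \<open>Only the last index \<open>j\<close> has a successor that wraps around to
      0.\<close>
    moreover have "(\<forall>i<m. P i (Suc i mod m)) \<longleftrightarrow> (\<forall>i. Suc i < m \<longrightarrow> P i (Suc i)) \<and> P j 0" for P
      unfolding m by (metis Suc_less_eq less_antisym lessI less_SucI mod_less mod_self)
    ultimately show ?thesis unfolding that by simp
  qed
  then show ?thesis by (auto simp: dicycles_def successively_conv_nth)
qed

lemma dicycles_subset:
  assumes "pair_wf_digraph G"
  shows "dicycles m G \<subseteq> {xs. set xs \<subseteq> pverts G \<and> length xs = m}"
proof -
  interpret pair_wf_digraph G by fact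
  show ?thesis by (fastforce simp: dicycles_def in_set_conv_nth dest: arc_fst_in_verts)
qed

section \<open>Robust families of cycles and the lengthening step\<close>

text \<open>
  Each discarding step removes at most \<open>d\<close> tuples and destroys at least one link, so the
  hypothesis persists.
\<close>

lemma ex_robust_subset:
  fixes T :: "'a list set"
  assumes "finite T" and len: "\<And>xs. xs \<in> T \<Longrightarrow> length xs = k"
    and "card T > d * card ((\<lambda>(i, xs). (i, take i xs @ drop (Suc i) xs)) ` ({..<k} \<times> T))"
  shows "\<exists>T'\<subseteq>T. T' \<noteq> {} \<and> (\<forall>xs\<in>T'. \<forall>i<k. card {v. xs[i := v] \<in> T'} > d)"
  using assms
proof (induction "card T" arbitrary: T rule: less_induct)
  case less
  \<comment> \<open>Recording the position along with the shortened tuple makes a link determine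
    which coordinate is free to vary.\<close>
  define link where "link = (\<lambda>(i, xs :: 'a list). (i, take i xs @ drop (Suc i) xs))"
  show ?case
  proof (cases "\<forall>xs\<in>T. \<forall>i<k. card {v. xs[i := v] \<in> T} > d")
    case True
    moreover have "T \<noteq> {}" using less.prems(3) by auto
    ultimately show ?thesis by blast
  next
    case False
    then obtain xs i where xs: "xs \<in> T" "i < k" "card {v. xs[i := v] \<in> T} \<le> d"
      by (auto simp: not_less)
    define D where "D = {ys \<in> T. link (i, ys) = link (i, xs)}"
    have lxs: "length xs = k" using xs less.prems(2) by blast
    have "D \<subseteq> (\<lambda>v. xs[i := v]) ` {v. xs[i := v] \<in> T}"
    proof
      fix ys assume "ys \<in> D"
      then have ys: "ys \<in> T" "take i ys = take i xs" "drop (Suc i) ys = drop (Suc i) xs"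
        using less.prems(2) lxs xs(2) by (auto simp: D_def link_def append_eq_append_conv)
      then have "length ys = k" using less.prems(2) by blast
      then have "ys = xs[i := ys ! i]"
        using ys xs(2) lxs by (metis id_take_nth_drop upd_conv_take_nth_drop)
      with ys(1) show "ys \<in> (\<lambda>v. xs[i := v]) ` {v. xs[i := v] \<in> T}"
        by (metis (mono_tags, lifting) image_eqI mem_Collect_eq)
    qed
    \<comment> \<open>An infinite set has \<open>card\<close> 0, so the bound \<open>d\<close> on
      the number of extensions says something only once they are finitely many.\<close>
    moreover have "finite {v. xs[i := v] \<in> T}"
    proof (rule finite_imageD)
      show "finite ((\<lambda>v. xs[i := v]) ` {v. xs[i := v] \<in> T})"
        by (rule finite_subset[OF _ less.prems(1)]) auto
      show "inj_on (\<lambda>v. xs[i := v]) {v. xs[i := v] \<in> T}"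
        using xs(2) lxs by (intro inj_onI) (metis nth_list_update_eq)
    qed
    ultimately have cD: "card D \<le> d"
      using xs(3) by (meson card_image_le card_mono finite_imageI order_trans)
    have xsD: "xs \<in> D" and DT: "D \<subseteq> T" using xs by (auto simp: D_def)
    have finD: "finite D" using DT less.prems(1) finite_subset by blast
    have cT: "card (T - D) = card T - card D" "card D \<le> card T"
      using card_Diff_subset[OF finD DT] card_mono[OF less.prems(1) DT] by auto
    have lt: "card (T - D) < card T"
      using xsD DT less.prems(1) by (intro psubset_card_mono) auto
    have "link ` ({..<k} \<times> (T - D)) \<subseteq> link ` ({..<k} \<times> T) - {link (i, xs)}"
      by (auto simp: D_def link_def)
    then have "card (link ` ({..<k} \<times> (T - D))) \<le> card (link ` ({..<k} \<times> T) - {link (i, xs)})"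
      using less.prems(1) by (intro card_mono) auto
    also have "\<dots> < card (link ` ({..<k} \<times> T))"
      using less.prems(1) xs by (intro psubset_card_mono) auto
    finally have "Suc (card (link ` ({..<k} \<times> (T - D)))) \<le> card (link ` ({..<k} \<times> T))"
      by simp
    then have "d * Suc (card (link ` ({..<k} \<times> (T - D)))) \<le> d * card (link ` ({..<k} \<times> T))"
      by (rule mult_le_mono2)
    then have "d * card (link ` ({..<k} \<times> (T - D))) < card (T - D)"
      using less.prems(3) cT cD unfolding link_def[symmetric] by (simp add: algebra_simps)
    then obtain T' where "T' \<subseteq> T - D" "T' \<noteq> {}" "\<forall>xs\<in>T'. \<forall>i<k. card {v. xs[i := v] \<in> T'} > d"
      using less.hyps[OF lt] less.prems(1,2) unfolding link_def by (metis DiffD1 finite_Diff)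
    then show ?thesis by blast
  qed
qed

text \<open>The detour from \<open>a0\<close> to \<open>a1\<close> runs through \<open>b1\<close>,
  the \<open>k - 2\<close> entries of \<open>bs'\<close>, and \<open>b0\<close>, which are
  \<open>k\<close> new vertices. At most \<open>c + 1\<close> vertices ever have to be avoided,
  hence \<open>c < d\<close>. The closing arc of \<open>cs\<close> is the one replaced.\<close>

lemma ex_longer_dicycle:
  fixes T :: "'a list set"
  assumes k: "k \<ge> 3" and T: "T \<subseteq> dicycles k G"
    and robust: "\<And>xs i. xs \<in> T \<Longrightarrow> i < k \<Longrightarrow> card {v. xs[i := v] \<in> T} > d"
    and cs: "cs \<in> dicycles c G" "c > 0" "c < d" and ab: "last cs # hd cs # bs \<in> T"
  shows "\<exists>cs' bs'. cs' \<in> dicycles (c + k) G \<and> last cs' # hd cs' # bs' \<in> T"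
proof -
  have fresh: "\<exists>v. v \<notin> S \<and> xs[i := v] \<in> T" if "xs \<in> T" "i < k" "finite S" "card S \<le> d" for xs i S
  proof (rule ccontr)
    assume "\<not> ?thesis"
    then have "{v. xs[i := v] \<in> T} \<subseteq> S" by auto
    from card_mono[OF that(3) this] that(4) robust[OF that(1,2)] show False by linarith
  qed
  obtain a0 a1 where a: "a0 = last cs" "a1 = hd cs" by simp
  have len: "length cs = c" and dist: "distinct cs" using cs(1) by (auto simp: dicycles_def)
  have lenb: "length bs = k - 2" using ab T by (auto simp: dicycles_def)
  \<comment> \<open>Robustness changes one coordinate at a time, so the entries of \<open>bs\<close>
    are moved off the cycle one by one; entry \<open>j\<close> of \<open>bs\<close> is coordinate
    \<open>j + 2\<close> of the tuple.\<close>
  have "\<exists>bs'. length bs' = k - 2 \<and> a0 # a1 # bs' \<in> T \<and> set (take j bs') \<inter> set cs = {}"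
    if "j \<le> k - 2" for j
    using that
  proof (induction j)
    case 0
    then show ?case using ab lenb a by (intro exI[of _ bs]) auto
  next
    case (Suc j)
    then obtain bs' where bs': "length bs' = k - 2" "a0 # a1 # bs' \<in> T" "set (take j bs') \<inter> set cs = {}"
      by auto
    have "Suc (Suc j) < k" using Suc.prems k by linarith
    then obtain v where "v \<notin> set cs" "(a0 # a1 # bs')[Suc (Suc j) := v] \<in> T"
      using fresh[OF bs'(2), of "Suc (Suc j)" "set cs"] cs(3) len dist
      by (auto simp: distinct_card)
    moreover have "set (take (Suc j) (bs'[j := v])) = insert v (set (take j bs'))"
      using Suc.prems bs'(1) by (simp add: take_Suc_conv_app_nth)
    ultimately show ?case
      using bs' by (intro exI[of _ "bs'[j := v]"]) auto
  qed
  from this[of "k - 2"] obtain bs' where bs': "length bs' = k - 2" "a0 # a1 # bs' \<in> T"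
    "set bs' \<inter> set cs = {}"
    by auto
  obtain b1 where b1: "b1 \<notin> set cs" "a0 # b1 # bs' \<in> T"
    using fresh[OF bs'(2), of 1 "set cs"] k cs(3) len dist by (auto simp: distinct_card)
  \<comment> \<open>The vertices \<open>b0\<close> and \<open>b1\<close> come from different tuples,
    so their distinctness has to be demanded here.\<close>
  obtain b0 where b0: "b0 \<notin> insert b1 (set cs)" "b0 # a1 # bs' \<in> T"
    using fresh[OF bs'(2), of 0 "insert b1 (set cs)"] k cs(3) len dist b1(1)
    by (auto simp: distinct_card)
  have ne: "cs \<noteq> []" "bs' \<noteq> []" using cs(2) len k bs'(1) by auto
  \<comment> \<open>These two cycles supply the arcs of the detour and show that neither
    \<open>b0\<close> nor \<open>b1\<close> occurs in \<open>bs'\<close>.\<close>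
  have "b0 # a1 # bs' \<in> dicycles k G" "a0 # b1 # bs' \<in> dicycles k G"
    using b0 b1 T by auto
  then have "cs @ b1 # bs' @ [b0] \<in> dicycles (c + k) G"
    using cs(1,2) k bs' b0(1) b1(1) ne a
    by (auto simp: dicycles_iff_successively successively_Cons successively_append_iff)
  then show ?thesis
    using b0(2) a ne by (intro exI[of _ "cs @ b1 # bs' @ [b0]"] exI[of _ bs']) simp
qed


section \<open>Upper bounds on the number of cycles\<close>

lemma dicycles_bound:
  assumes "pair_digraph G"
  shows "finite (dicycles m G)" "card (dicycles m G) \<le> card (pverts G) ^ m"
proof -
  interpret pair_digraph G by fact
  have sub: "dicycles m G \<subseteq> {xs. set xs \<subseteq> pverts G \<and> length xs = m}"
    by (rule dicycles_subset) unfold_locales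
  note fin = finite_lists_length_eq[OF pair_finite_verts, of m]
  show "finite (dicycles m G)" by (rule finite_subset[OF sub fin])
  show "card (dicycles m G) \<le> card (pverts G) ^ m"
    using card_mono[OF fin sub] by (simp add: card_lists_length_eq[OF pair_finite_verts])
qed

lemma card_copies_dicycle_le:
  assumes "pair_digraph G"
  shows "card (copies (dicycle m) G) \<le> card (dicycles m G)"
proof -
  interpret pair_digraph G by fact
  have "pair_wf_digraph G" by unfold_locales
  then show ?thesis
    by (simp add: copies_dicycle card_image_le dicycles_bound[OF assms])
qed

text \<open>There are at most \<open>k\<close> times \<open>n ^ (k - 1)\<close> links, where
  \<open>n\<close> is the order of \<open>G\<close>. The threshold \<open>d = k * m\<close> exceeds
  the length of every cycle that is still to be lengthened, and \<open>m - 1\<close> lengthenings of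
  a \<open>k\<close>-cycle reach length \<open>k * m\<close>.\<close>

lemma card_dicycles_le_if_multiple_free:
  assumes G: "pair_digraph G" and k: "k \<ge> 3" and m: "m > 0" and free: "dicycles (k * m) G = {}"
  shows "card (dicycles k G) \<le> k * m * k * card (pverts G) ^ (k - 1)"
proof (rule ccontr)
  assume contr: "\<not> ?thesis"
  interpret pair_digraph G by fact
  let ?T = "dicycles k G" and ?link = "\<lambda>(i, xs :: 'a list). (i, take i xs @ drop (Suc i) xs)"
  let ?L = "{ys. set ys \<subseteq> pverts G \<and> length ys = k - 1}"
  have sub: "?T \<subseteq> {xs. set xs \<subseteq> pverts G \<and> length xs = k}"
    by (rule dicycles_subset) unfold_locales
  have "?link ` ({..<k} \<times> ?T) \<subseteq> {..<k} \<times> ?L"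
  proof (clarsimp simp del: set_append length_append)
    fix i xs assume i: "i < k" and "xs \<in> ?T"
    then have "set xs \<subseteq> pverts G" "length xs = k" using sub by auto
    with i show "set (take i xs @ drop (Suc i) xs) \<subseteq> pverts G \<and>
        length (take i xs @ drop (Suc i) xs) = k - Suc 0"
      by (auto dest: in_set_takeD in_set_dropD)
  qed
  then have "card (?link ` ({..<k} \<times> ?T)) \<le> card ({..<k} \<times> ?L)"
    by (intro card_mono) (auto simp: finite_lists_length_eq[OF pair_finite_verts])
  also have "\<dots> = k * card (pverts G) ^ (k - 1)"
    by (simp add: card_cartesian_product card_lists_length_eq[OF pair_finite_verts])
  finally have "k * m * card (?link ` ({..<k} \<times> ?T)) \<le> k * m * (k * card (pverts G) ^ (k - 1))"
    by (rule mult_le_mono2)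
  with contr have "k * m * card (?link ` ({..<k} \<times> ?T)) < card ?T"
    unfolding mult.assoc by linarith
  then obtain T' where T': "T' \<subseteq> ?T" "T' \<noteq> {}"
    and robust: "\<And>xs i. xs \<in> T' \<Longrightarrow> i < k \<Longrightarrow> card {v. xs[i := v] \<in> T'} > k * m"
    using ex_robust_subset[of ?T k "k * m"] dicycles_bound(1)[OF G] sub by blast
  have "\<exists>cs bs. cs \<in> dicycles (k * Suc j) G \<and> last cs # hd cs # bs \<in> T'" if "Suc j \<le> m" for j
    using that
  proof (induction j)
    case 0
    obtain xs where xs: "xs \<in> T'" "xs \<in> ?T" using T' by blast
    then have "length xs = k" by (auto simp: dicycles_def)
    then obtain a b c bs where abc: "xs = a # b # c # bs"
      using k by (auto simp: numeral_3_eq_3 Suc_le_length_iff)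
    \<comment> \<open>Rotating the tuple by one place makes \<open>a b\<close> the closing arc,
      while the unrotated tuple in \<open>T'\<close> begins with that arc.\<close>
    have "b # c # bs @ [a] \<in> ?T"
      using xs(2) k unfolding abc
      by (cases bs)
         (auto simp: dicycles_iff_successively successively_append_iff successively_Cons split: if_splits)
    then show ?case using xs(1) abc
      by (intro exI[of _ "b # c # bs @ [a]"] exI[of _ "c # bs"]) simp
  next
    case (Suc j)
    then obtain cs bs where "cs \<in> dicycles (k * Suc j) G" "last cs # hd cs # bs \<in> T'" by auto
    moreover have "k * Suc j > 0" "k * Suc j < k * m"
      using k Suc.prems by (simp, intro mult_less_mono2) simp_all
    ultimately show ?case
      using ex_longer_dicycle[OF k T'(1) robust, of cs "k * Suc j" bs]
      by (simp add: algebra_simps)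
  qed
  from this[of "m - 1"] show False using m free by simp
qed

section \<open>Blow-ups of the directed cycle\<close>

text \<open>The class of a vertex is its residue modulo \<open>k\<close>. Vertices outside
  \<open>A\<close> stay as isolated vertices, so that the order is \<open>n\<close> for every
  \<open>A\<close>.\<close>

definition blowup :: "nat \<Rightarrow> nat set \<Rightarrow> nat \<Rightarrow> nat pair_pre_digraph" where
  "blowup k A n = \<lparr> pverts = {..<n},
     parcs = {(u, v). u < n \<and> v < n \<and> u \<in> A \<and> v \<in> A \<and> v mod k = Suc u mod k} \<rparr>"

text \<open>Modulo \<open>k\<close>, residue \<open>r\<close> differs from \<open>r + 1\<close>,
  which excludes loops, and from \<open>r + 2\<close>, which excludes opposite arcs; the latter uses
  \<open>k \<ge> 3\<close>.\<close>

lemma oriented_blowup: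
  assumes "k \<ge> 3"
  shows "oriented_graph (blowup k A n)"
proof -
  have loop: "u mod k \<noteq> Suc u mod k" for u
    using assms by (simp add: mod_Suc)
  have two: "u mod k \<noteq> Suc v mod k" if "v mod k = Suc u mod k" for u v
    using assms that mod_less_divisor[of k u] by (auto simp: mod_Suc split: if_splits)
  have "finite (parcs (blowup k A n))"
    by (rule finite_subset[of _ "{..<n} \<times> {..<n}"]) (auto simp: blowup_def)
  then have "pair_digraph (blowup k A n)"
    using loop by unfold_locales (auto simp: blowup_def)
  then show ?thesis
    using two by (auto simp: oriented_graph_def blowup_def)
qed

lemma pair_wf_blowup: "pair_wf_digraph (blowup k A n)"
  by unfold_locales (auto simp: blowup_def)

lemma dicycles_blowup_mod:
  assumes "xs \<in> dicycles m (blowup k A n)" "i < m"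
  shows "xs ! i mod k = (xs ! 0 + i) mod k"
  using assms(2)
proof (induction i)
  case (Suc i)
  then have "(xs ! i, xs ! (Suc i mod m)) \<in> parcs (blowup k A n)"
    by (intro arc_of_dicycles[OF assms(1)]) simp
  then have "xs ! Suc i mod k = Suc (xs ! i) mod k"
    using Suc.prems by (simp add: blowup_def)
  also have "\<dots> = Suc (xs ! 0 + i) mod k"
    using Suc by (metis Suc_lessD mod_Suc_eq)
  finally show ?case by simp
qed simp

text \<open>One turn around the cycle raises the residue by \<open>m\<close> and ends where it
  began.\<close>

lemma dvd_if_dicycles_blowup:
  assumes "xs \<in> dicycles m (blowup k A n)" "m > 0"
  shows "k dvd m"
proof -
  have "(xs ! (m - 1), xs ! (Suc (m - 1) mod m)) \<in> parcs (blowup k A n)"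
    using assms(2) by (intro arc_of_dicycles[OF assms(1)]) simp
  then have "xs ! 0 mod k = Suc (xs ! (m - 1)) mod k"
    using assms(2) by (simp add: blowup_def)
  also have "\<dots> = Suc (xs ! 0 + (m - 1)) mod k"
    using dicycles_blowup_mod[OF assms(1), of "m - 1"] assms(2) by (metis mod_Suc_eq diff_less zero_less_one)
  also have "\<dots> = (xs ! 0 + m) mod k" using assms(2) by simp
  finally show ?thesis
    by (metis add_diff_cancel_left' le_add1 mod_eq_dvd_iff_nat)
qed

text \<open>A cycle this long meets class 0 at two positions \<open>i\<close> and
  \<open>i + k\<close>, but 0 is the only vertex of that class incident with arcs.\<close>

lemma dicycles_blowup_singleton:
  assumes "k > 0" "2 * k \<le> m"
  shows "dicycles m (blowup k {v. k dvd v \<longrightarrow> v = 0} n) = {}"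
proof (rule ccontr)
  assume "\<not> ?thesis"
  then obtain xs where xs: "xs \<in> dicycles m (blowup k {v. k dvd v \<longrightarrow> v = 0} n)" by auto
  \<comment> \<open>With this choice \<open>xs ! 0 + i\<close> is \<open>xs ! 0\<close> rounded up
    to a multiple of \<open>k\<close>, so \<open>i\<close> is the first position in class 0.\<close>
  define i where "i = k - 1 - (xs ! 0 + (k - 1)) mod k"
  have less: "(xs ! 0 + (k - 1)) mod k < k" using assms by simp
  have zero: "xs ! j = 0" if "j < m" "k dvd xs ! 0 + j" for j
  proof -
    have "k dvd xs ! j"
      using that dicycles_blowup_mod[OF xs that(1)] by (simp add: dvd_eq_mod_eq_0)
    moreover have "(xs ! j, xs ! (Suc j mod m)) \<in> parcs (blowup k {v. k dvd v \<longrightarrow> v = 0} n)"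
      by (rule arc_of_dicycles[OF xs that(1)])
    ultimately show ?thesis by (simp add: blowup_def)
  qed
  have "xs ! 0 + i = (xs ! 0 + (k - 1)) - (xs ! 0 + (k - 1)) mod k"
    using less assms(1) unfolding i_def by linarith
  then have dvd: "k dvd xs ! 0 + i" by (simp add: dvd_minus_mod)
  have i: "i < k" using assms(1) by (simp add: i_def)
  have "k dvd xs ! 0 + (i + k)" using dvd by (metis add.assoc dvd_add dvd_refl)
  then have "xs ! (i + k) = xs ! i"
    using zero[of i] zero[of "i + k"] dvd i assms(2) by simp
  moreover have "distinct xs" "length xs = m" using xs by (auto simp: dicycles_def)
  ultimately show False
    using i assms by (simp add: nth_eq_iff_index_eq)
qed

text \<open>A tuple \<open>ys\<close> selects the vertex \<open>i + k * ys ! i\<close> from class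
  \<open>i\<close>. Residues recover \<open>ys\<close> from the vertex set of the cycle alone, so no
  two tuples give the same copy.\<close>

lemma card_copies_blowup_ge:
  assumes k: "k > 0" and Y: "Y \<subseteq> {ys. set ys \<subseteq> {..<n div k} \<and> length ys = k}"
    and A: "\<And>ys i. ys \<in> Y \<Longrightarrow> i < k \<Longrightarrow> i + k * ys ! i \<in> A"
  shows "card Y \<le> card (copies (dicycle k) (blowup k A n))"
proof -
  define lift where "lift ys = map (\<lambda>i. i + k * ys ! i) [0..<k]" for ys
  have "lift ys \<in> dicycles k (blowup k A n)" if "ys \<in> Y" for ys
  proof -
    have ys: "set ys \<subseteq> {..<n div k}" "length ys = k" using that Y by auto
    have less: "i + k * ys ! i < n" if "i < k" for i
    proof -
      have "ys ! i < n div k" using ys that nth_mem by fastforce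
      then have "k * Suc (ys ! i) \<le> k * (n div k)" by (intro mult_le_mono2) simp
      also have "\<dots> \<le> n" by simp
      finally show ?thesis using that by simp
    qed
    have "inj_on (\<lambda>i. i + k * ys ! i) {..<k}"
      by (rule inj_on_inverseI[of _ "\<lambda>v. v mod k"]) simp
    then have "distinct (lift ys)" by (simp add: lift_def distinct_map atLeast0LessThan)
    then show ?thesis
      using less A[OF that] k by (auto simp: dicycles_def lift_def blowup_def mod_simps)
  qed
  then have "(dicycle_of \<circ> lift) ` Y \<subseteq> copies (dicycle k) (blowup k A n)"
    by (auto simp: copies_dicycle[OF pair_wf_blowup])
  moreover have "inj_on (dicycle_of \<circ> lift) Y"
  proof (rule inj_onI)
    fix ys zs assume yz: "ys \<in> Y" "zs \<in> Y" "(dicycle_of \<circ> lift) ys = (dicycle_of \<circ> lift) zs"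
    have "pverts (dicycle_of (lift ys)) = pverts (dicycle_of (lift zs))" using yz(3) by simp
    then have set_eq: "(\<lambda>i. i + k * ys ! i) ` {..<k} = (\<lambda>i. i + k * zs ! i) ` {..<k}"
      by (simp add: lift_def atLeast0LessThan)
    show "ys = zs"
    proof (rule nth_equalityI)
      show "length ys = length zs" using yz Y by auto
      fix i assume "i < length ys"
      then have i: "i < k" using yz Y by auto
      then obtain j where j: "j < k" "i + k * ys ! i = j + k * zs ! j"
        using set_eq by (metis (no_types, lifting) imageE imageI lessThan_iff)
      then have "(i + k * ys ! i) mod k = (j + k * zs ! j) mod k" by simp
      then have "i = j" using i j(1) by simp
      then show "ys ! i = zs ! i" using j k by simp
    qed
  qed
  moreover have "finite (copies (dicycle k) (blowup k A n))"
    unfolding copies_dicycle[OF pair_wf_blowup]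
    by (intro finite_imageI finite_subset[OF dicycles_subset[OF pair_wf_blowup]] finite_lists_length_eq)
       (simp add: blowup_def)
  ultimately show ?thesis by (metis card_inj_on_le)
qed

section \<open>Extremal numbers and their order of magnitude\<close>

lemma ex_oriented_le:
  assumes "l \<ge> 2"
    and "\<And>G :: nat pair_pre_digraph. oriented_graph G \<Longrightarrow> card (pverts G) = n \<Longrightarrow>
           copies (dicycle l) G = {} \<Longrightarrow> card (copies H G) \<le> b"
  shows "ex_oriented n H (dicycle l) \<le> b"
  unfolding ex_oriented_def
  using assms copy_numbers_nonempty[OF assms(1), of n H] finite_copy_numbers
  by (subst Max_le_iff) (auto simp: copy_numbers_def)

lemma ex_oriented_ge:
  fixes G :: "nat pair_pre_digraph"
  assumes "oriented_graph G" "copies F G = {}"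
  shows "card (copies H G) \<le> ex_oriented (card (pverts G)) H F"
  unfolding ex_oriented_def
  using assms finite_copy_numbers by (intro Max_ge) (auto simp: copy_numbers_def)

text \<open>Rounding down costs only a constant factor: for \<open>n \<ge> k\<close> the remainder
  is below \<open>k \<le> k * (n div k)\<close>, whence
  \<open>n \<le> 2 * k * (n div k)\<close>.\<close>

lemma bigtheta_power_if_bounds:
  fixes f :: "nat \<Rightarrow> nat"
  assumes k: "k > 0" and lower: "\<And>n. (n div k) ^ p \<le> f n" and upper: "\<And>n. f n \<le> C * n ^ p"
  shows "(\<lambda>n. real (f n)) \<in> \<Theta>(\<lambda>n. real n ^ p)"
proof
  have "real (f n) \<le> real C * real n ^ p" for n
    using upper[of n] by (metis of_nat_le_iff of_nat_mult of_nat_power)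
  then show "(\<lambda>n. real (f n)) \<in> O(\<lambda>n. real n ^ p)"
    by (intro bigoI[of _ "real C"]) auto
  have "real n ^ p \<le> real ((2 * k) ^ p) * real (f n)" if "n \<ge> k" for n
  proof -
    have "1 \<le> n div k" using that k by (simp add: Suc_le_eq div_greater_zero_iff)
    then have "k * 1 \<le> k * (n div k)" by (rule mult_le_mono2)
    moreover have "n = k * (n div k) + n mod k" "n mod k < k" using k by simp_all
    ultimately have "n \<le> 2 * k * (n div k)" by linarith
    then have "n ^ p \<le> (2 * k) ^ p * (n div k) ^ p"
      by (metis power_mono power_mult_distrib zero_le)
    also have "\<dots> \<le> (2 * k) ^ p * f n" using lower by simp
    finally show ?thesis by (metis of_nat_le_iff of_nat_mult of_nat_power)
  qed
  then have "(\<lambda>n. real n ^ p) \<in> O(\<lambda>n. real (f n))"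
    by (intro bigoI[of _ "real ((2 * k) ^ p)"] eventually_sequentiallyI[of k]) auto
  then show "(\<lambda>n. real (f n)) \<in> \<Omega>(\<lambda>n. real n ^ p)"
    by (simp add: bigomega_iff_bigo)
qed

theorem theorem2p1:
  fixes k l :: nat
  assumes "k \<ge> 3" and "l \<ge> 3" and "k \<noteq> l"
  shows "(\<not> k dvd l \<longrightarrow>
            (\<lambda>n. real (ex_oriented n (dicycle k) (dicycle l))) \<in> \<Theta>(\<lambda>n. real n ^ k)) \<and>
         (k dvd l \<longrightarrow>
            (\<lambda>n. real (ex_oriented n (dicycle k) (dicycle l))) \<in> \<Theta>(\<lambda>n. real n ^ (k - 1)))"
proof (intro conjI impI)
  \<comment> \<open>Both cases use this bound: \<open>Y\<close> is the family of all tuples for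
    \<open>A = UNIV\<close>, and the tuples starting with 0 when class 0 is reduced to one
    vertex.\<close>
  have lower: "card Y \<le> ex_oriented n (dicycle k) (dicycle l)"
    if "dicycles l (blowup k A n) = {}" "Y \<subseteq> {ys. set ys \<subseteq> {..<n div k} \<and> length ys = k}"
      "\<And>ys i. ys \<in> Y \<Longrightarrow> i < k \<Longrightarrow> i + k * ys ! i \<in> A" for A Y n
  proof -
    have "card Y \<le> card (copies (dicycle k) (blowup k A n))"
      using assms(1) that(2,3) by (intro card_copies_blowup_ge) auto
    also have "\<dots> \<le> ex_oriented (card (pverts (blowup k A n))) (dicycle k) (dicycle l)"
      using oriented_blowup[OF assms(1)] that(1)
      by (intro ex_oriented_ge) (auto simp: copies_dicycle[OF pair_wf_blowup])
    finally show ?thesis by (simp add: blowup_def)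
  qed
  have "k > 0" "l \<ge> 2" "l > 0" using assms by auto
  {
    assume ndvd: "\<not> k dvd l"
    show "(\<lambda>n. real (ex_oriented n (dicycle k) (dicycle l))) \<in> \<Theta>(\<lambda>n. real n ^ k)"
    proof (rule bigtheta_power_if_bounds[OF \<open>k > 0\<close>])
      fix n
      have "dicycles l (blowup k UNIV n) = {}"
        using dvd_if_dicycles_blowup ndvd \<open>l > 0\<close> by blast
      from lower[OF this order_refl]
      show "(n div k) ^ k \<le> ex_oriented n (dicycle k) (dicycle l)"
        by (simp add: card_lists_length_eq)
      show "ex_oriented n (dicycle k) (dicycle l) \<le> 1 * n ^ k"
      proof (rule ex_oriented_le[OF \<open>l \<ge> 2\<close>])
        fix G :: "nat pair_pre_digraph"
        assume "oriented_graph G" "card (pverts G) = n"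
        then show "card (copies (dicycle k) G) \<le> 1 * n ^ k"
          using card_copies_dicycle_le[of G k] dicycles_bound(2)[of G k]
          by (auto simp: oriented_graph_def)
      qed
    qed
  next
    assume "k dvd l"
    then obtain m where l: "l = k * m" by blast
    \<comment> \<open>As \<open>l\<close> is positive and differs from \<open>k\<close>, the factor
      \<open>m\<close> is neither 0 nor 1; hence \<open>l \<ge> 2 * k\<close>, as
      \<open>dicycles_blowup_singleton\<close> requires.\<close>
    then have m: "m \<ge> 2" using assms by (cases m; cases "m - 1") auto
    show "(\<lambda>n. real (ex_oriented n (dicycle k) (dicycle l))) \<in> \<Theta>(\<lambda>n. real n ^ (k - 1))"
    proof (rule bigtheta_power_if_bounds[OF \<open>k > 0\<close>])
      fix n
      define A where "A = {v. k dvd v \<longrightarrow> v = 0}"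
      define Z where "Z = {zs. set zs \<subseteq> {..<n div k} \<and> length zs = k - 1}"
      have Z: "card Z = (n div k) ^ (k - 1)" by (simp add: Z_def card_lists_length_eq)
      show "(n div k) ^ (k - 1) \<le> ex_oriented n (dicycle k) (dicycle l)"
      \<comment> \<open>If \<open>n div k = 0\<close>, the entry 0 is not allowed in a tuple, but
        then the claimed bound is 0 because \<open>k - 1 > 0\<close>.\<close>
      proof (cases "n div k = 0")
        case True
        then show ?thesis using assms(1) by (simp add: power_0_left)
      next
        case False
        \<comment> \<open>The leading 0 selects vertex 0 in class 0; the other \<open>k - 1\<close>
          entries are free.\<close>
        have "card ((#) 0 ` Z) \<le> ex_oriented n (dicycle k) (dicycle l)"
        proof (rule lower)
          show "dicycles l (blowup k A n) = {}"
            unfolding A_def using dicycles_blowup_singleton[OF \<open>k > 0\<close>] l m by simp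
          show "(#) 0 ` Z \<subseteq> {ys. set ys \<subseteq> {..<n div k} \<and> length ys = k}"
            using False \<open>k > 0\<close> by (auto simp: Z_def)
          fix ys i assume "ys \<in> (#) 0 ` Z" "i < k"
          then show "i + k * ys ! i \<in> A"
            by (cases "i = 0") (auto simp: A_def dvd_add_left_iff dest: dvd_imp_le)
        qed
        then show ?thesis by (simp add: card_image Z)
      qed
      show "ex_oriented n (dicycle k) (dicycle l) \<le> k * m * k * n ^ (k - 1)"
      proof (rule ex_oriented_le[OF \<open>l \<ge> 2\<close>])
        fix G :: "nat pair_pre_digraph"
        assume G: "oriented_graph G" "card (pverts G) = n" "copies (dicycle l) G = {}"
        then have pd: "pair_digraph G" by (simp add: oriented_graph_def)
        interpret pair_digraph G by fact
        have "dicycles (k * m) G = {}"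
          using G(3) copies_dicycle[of G l] l by auto
        then show "card (copies (dicycle k) G) \<le> k * m * k * n ^ (k - 1)"
          using card_dicycles_le_if_multiple_free[OF pd assms(1), of m] m G(2)
            card_copies_dicycle_le[OF pd, of k] by simp
      qed
    qed
  }
qed

end
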